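(* Let $k,n\ge 2$, let $\mathcal{T}=(t_{i_1\ldots i_k})$ be a symmetric, nonnegative, zero diagonal tensor of order $k$ and dimension $n$, and let $\mathbf{x}$ be a unit nonnegative eigenvector of $\mathcal{T}$ corresponding to $\lambda_{\max}(\mathcal{T})$. Let $\emptyset\ne I\subset[n]$ be a proper subset. If $\sum_{i\in I}x_i^k\ne 0$, then $$\frac{\lambda_{\max}(\mathcal{T})\Bigl(1-k\sum_{i\in [n]\setminus I} x_i^k\Bigr)-\sum_{j=1}^{k-1}(-1)^j\binom{k}{j+1}\sum_{\substack{i_1,\ldots,i_{j+1}\in [n]\setminus I\\ i_{j+2},\ldots, i_k\in [n]}}t_{i_1 \ldots i_k} x_{i_1}\cdots x_{i_k}}{\sum_{i\in I} x_i^k}\ \le\ \rho(\mathcal{T}[I])\ \le\ \rho(\mathcal{T}).$$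
   Context: $[n]=\{1,\dots,n\}$. A real tensor $\mathcal{T}=(t_{i_1\ldots i_k})$ of order $k$ and dimension $n$ is an array of reals indexed by $(i_1,\dots,i_k)\in[n]^k$. It is symmetric if its entries are invariant under all permutations of the indices, zero diagonal if $t_{i\ldots i}=0$ for all $i\in[n]$, and nonnegative if all entries are $\ge 0$. For a vector $\mathbf{x}$, $(\mathcal{T}\mathbf{x}^{k-1})_i=\sum_{i_2,\dots,i_k\in[n]}t_{ii_2\dots i_k}x_{i_2}\cdots x_{i_k}$. A complex number $\lambda$ is an eigenvalue of $\mathcal{T}$ with eigenvector $\mathbf{x}\neq 0$ if $\lambda x_i^{k-1}=(\mathcal{T}\mathbf{x}^{k-1})_i$ for all $i\in[n]$; it is an H-eigenvalue if both $\lambda$ and $\mathbf{x}$ are real. The spectral radius $\rho(\mathcal{T})$ is the largest modulus of the eigenvalues of $\mathcal{T}$, and $\lambda_{\max}(\mathcal{T})$ is the largest H-eigenvalue; for nonnegative $\mathcal{T}$ it exists and $\lambda_{\max}(\mathcal{T})=\rho(\mathcal{T})$. A vector $\mathbf{x}\in\mathbb{R}^n$ is unit if $\sum_{i}|x_i|^k=1$. For nonempty $I\subseteq[n]$, the principal subtensor $\mathcal{T}[I]$ is the tensor of order $k$ and dimension $|I|$ with entries $t_{i_1\ldots i_k}$, $i_1,\dots,i_k\in I$. *)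

theory Defs
  imports Complex_Main "HOL-Library.FuncSet" "HOL-Combinatorics.Permutations"
begin

text \<open>
  A real tensor of order \<open>k\<close> whose indices range over a finite set \<open>S\<close> is a function \<open>T\<close> on lists;
  only its values on \<open>tensor_indices k S\<close> matter, and vectors are functions that matter only on \<open>S\<close>.
  Dimension \<open>n\<close> is \<open>S = {1..n}\<close>; a principal subtensor keeps its index set \<open>I\<close>, of size \<open>card I\<close>,
  instead of being renumbered by \<open>{1..card I}\<close>.
\<close>

definition tensor_indices :: "nat \<Rightarrow> nat set \<Rightarrow> nat list set" where
  "tensor_indices k S = {ix. length ix = k \<and> set ix \<subseteq> S}"

definition symmetric_tensor :: "nat \<Rightarrow> nat set \<Rightarrow> (nat list \<Rightarrow> real) \<Rightarrow> bool" where
  "symmetric_tensor k S T \<longleftrightarrow>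
     (\<forall>ix \<in> tensor_indices k S. \<forall>p. p permutes {..<k} \<longrightarrow> T (permute_list p ix) = T ix)"

definition zero_diagonal_tensor :: "nat \<Rightarrow> nat set \<Rightarrow> (nat list \<Rightarrow> real) \<Rightarrow> bool" where
  "zero_diagonal_tensor k S T \<longleftrightarrow> (\<forall>i\<in>S. T (replicate k i) = 0)"

definition nonneg_tensor :: "nat \<Rightarrow> nat set \<Rightarrow> (nat list \<Rightarrow> real) \<Rightarrow> bool" where
  "nonneg_tensor k S T \<longleftrightarrow> (\<forall>ix \<in> tensor_indices k S. 0 \<le> T ix)"

definition principal_subtensor :: "nat \<Rightarrow> (nat list \<Rightarrow> real) \<Rightarrow> nat set \<Rightarrow> nat list \<Rightarrow> real" where
  "principal_subtensor k T I = restrict T (tensor_indices k I)"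

text \<open>
  The vector \<open>T x\<^sup>k\<^sup>-\<^sup>1\<close>, over any real field so as to cover both real and complex vectors.
\<close>

definition tensor_apply ::
    "nat \<Rightarrow> nat set \<Rightarrow> (nat list \<Rightarrow> real) \<Rightarrow> (nat \<Rightarrow> 'a::real_field) \<Rightarrow> nat \<Rightarrow> 'a" where
  "tensor_apply k S T x i =
     (\<Sum>ix \<in> tensor_indices (k - 1) S. of_real (T (i # ix)) * prod_list (map x ix))"

definition tensor_eigenvector ::
    "nat \<Rightarrow> nat set \<Rightarrow> (nat list \<Rightarrow> real) \<Rightarrow> 'a::real_field \<Rightarrow> (nat \<Rightarrow> 'a) \<Rightarrow> bool" where
  "tensor_eigenvector k S T l x \<longleftrightarrow>
     (\<exists>i\<in>S. x i \<noteq> 0) \<and> (\<forall>i\<in>S. l * x i ^ (k - 1) = tensor_apply k S T x i)"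

definition tensor_eigenvalue :: "nat \<Rightarrow> nat set \<Rightarrow> (nat list \<Rightarrow> real) \<Rightarrow> complex \<Rightarrow> bool" where
  "tensor_eigenvalue k S T l \<longleftrightarrow> (\<exists>x :: nat \<Rightarrow> complex. tensor_eigenvector k S T l x)"

definition H_eigenvalue :: "nat \<Rightarrow> nat set \<Rightarrow> (nat list \<Rightarrow> real) \<Rightarrow> real \<Rightarrow> bool" where
  "H_eigenvalue k S T l \<longleftrightarrow> (\<exists>x :: nat \<Rightarrow> real. tensor_eigenvector k S T l x)"

text \<open>
  The next two values are unspecified if no largest element exists; for symmetric nonnegative
  tensors of order at least 2 on a finite nonempty index set both exist.
\<close>

definition tensor_spectral_radius :: "nat \<Rightarrow> nat set \<Rightarrow> (nat list \<Rightarrow> real) \<Rightarrow> real" where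
  "tensor_spectral_radius k S T = (GREATEST r. \<exists>l. tensor_eigenvalue k S T l \<and> r = cmod l)"

definition lambda_max :: "nat \<Rightarrow> nat set \<Rightarrow> (nat list \<Rightarrow> real) \<Rightarrow> real" where
  "lambda_max k S T = (GREATEST l. H_eigenvalue k S T l)"

definition unit_vector :: "nat \<Rightarrow> nat set \<Rightarrow> (nat \<Rightarrow> real) \<Rightarrow> bool" where
  "unit_vector k S x \<longleftrightarrow> (\<Sum>i\<in>S. \<bar>x i\<bar> ^ k) = 1"

end

theory Submission
  imports Defs "HOL-Analysis.Function_Topology"
begin

text \<open>
  Write \<open>T x\<^sup>k\<close> for the sum of all \<open>t\<^sub>i\<^sub>1\<^sub>\<dots>\<^sub>i\<^sub>k x\<^sub>i\<^sub>1 \<cdots> x\<^sub>i\<^sub>k\<close>. Two facts carry the proof.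

  The first is variational: for a symmetric nonnegative tensor, the spectral radius is the maximum
  of \<open>T x\<^sup>k\<close> over nonnegative unit vectors (\<open>tensor_spectral_radius_attained\<close>). By compactness a
  maximizer \<open>y\<close> exists; symmetry turns the partial derivatives of \<open>T x\<^sup>k\<close> into
  \<open>k (T x\<^sup>k\<^sup>-\<^sup>1)\<^sub>i\<close>, so the first-order conditions say that \<open>y\<close> is an eigenvector for the maximal
  value. Conversely, taking absolute values in the eigenvalue equation of a complex eigenvector
  \<open>z\<close> and pairing it with \<open>\<bar>z\<bar>\<close> shows that no eigenvalue exceeds the maximum in modulus.
  The upper bound of the theorem follows at once, because a test vector on \<open>I\<close> extended by zero
  is a test vector on the whole index set.

  The second is inclusion-exclusion over the positions of an index tuple that lie outside \<open>I\<close>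
  (\<open>tensor_form_inclusion_exclusion\<close>): it expresses \<open>T[I] x\<^sup>k\<close> through the sums in which at least
  the first \<open>m\<close> positions lie outside \<open>I\<close>. The eigenvalue equation evaluates the terms \<open>m = 0\<close>
  and \<open>m = 1\<close>, and the result is exactly the numerator in the theorem. The lower bound is
  therefore the Rayleigh quotient of \<open>T[I]\<close> at the restriction of \<open>x\<close> to \<open>I\<close>.
\<close>

section \<open>The homogeneous form of a tensor\<close>

text \<open>
  This is the homogeneous polynomial \<open>T x\<^sup>k\<close> of degree \<open>k\<close>.
\<close>

definition tensor_form :: "nat \<Rightarrow> nat set \<Rightarrow> (nat list \<Rightarrow> real) \<Rightarrow> (nat \<Rightarrow> real) \<Rightarrow> real" where
  "tensor_form k S T x = (\<Sum>ix \<in> tensor_indices k S. T ix * prod_list (map x ix))"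

lemma finite_tensor_indices: "finite S \<Longrightarrow> finite (tensor_indices k S)"
  using finite_lists_length_eq[of S k] by (simp add: tensor_indices_def conj_commute)

lemma tensor_indices_mono: "I \<subseteq> S \<Longrightarrow> tensor_indices k I \<subseteq> tensor_indices k S"
  by (auto simp: tensor_indices_def)

lemma prod_list_map_conv_prod_nth:
  "prod_list (map f ix) = (\<Prod>q<length ix. f (ix ! q) :: 'a::comm_monoid_mult)"
  by (simp add: prod.list_conv_set_nth atLeast0LessThan)

lemma prod_list_map_nonneg:
  fixes x :: "'b \<Rightarrow> real"
  shows "(\<And>i. i \<in> set ix \<Longrightarrow> 0 \<le> x i) \<Longrightarrow> 0 \<le> prod_list (map x ix)"
  by (induction ix) auto

lemma sum_tensor_indices_Suc:
  assumes "finite S"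
  shows "(\<Sum>ix \<in> tensor_indices (Suc m) S. F ix) =
         (\<Sum>i\<in>S. \<Sum>ix \<in> tensor_indices m S. F (i # ix))"
proof -
  have "(\<Sum>ix \<in> tensor_indices (Suc m) S. F ix) =
        (\<Sum>(i, ix) \<in> S \<times> tensor_indices m S. F (i # ix))"
    by (rule sum.reindex_bij_witness[where i = "\<lambda>(i, ix). i # ix" and j = "\<lambda>ix. (hd ix, tl ix)"])
       (auto simp: tensor_indices_def length_Suc_conv)
  then show ?thesis
    by (simp add: sum.cartesian_product)
qed

text \<open>
  Grouping the tuples by their first index gives Euler's identity
  \<open>T x\<^sup>k = \<Sum> x\<^sub>i (T x\<^sup>k\<^sup>-\<^sup>1)\<^sub>i\<close> when \<open>J = S\<close>; for smaller \<open>J\<close> it evaluates the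
  first-order term of the inclusion-exclusion formula.
\<close>

lemma sum_form_split_first:
  assumes "finite S" "J \<subseteq> S" "k \<ge> 1"
  shows "(\<Sum>ix | ix \<in> tensor_indices k S \<and> set (take 1 ix) \<subseteq> J. T ix * prod_list (map x ix)) =
         (\<Sum>i\<in>J. x i * tensor_apply k S T x i)"
proof -
  obtain m where k: "k = Suc m"
    using assms(3) by (cases k) auto
  have "(\<Sum>ix | ix \<in> tensor_indices k S \<and> set (take 1 ix) \<subseteq> J. T ix * prod_list (map x ix)) =
        (\<Sum>ix\<in>tensor_indices k S. if set (take 1 ix) \<subseteq> J then T ix * prod_list (map x ix) else 0)"
    using finite_tensor_indices[OF assms(1)] by (intro sum.inter_filter)
  also have "\<dots> = (\<Sum>i\<in>S. if i \<in> J then x i * tensor_apply k S T x i else 0)"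
    unfolding k sum_tensor_indices_Suc[OF assms(1)]
    by (intro sum.cong) (auto simp: tensor_apply_def sum_distrib_left mult_ac)
  also have "\<dots> = (\<Sum>i\<in>J. x i * tensor_apply k S T x i)"
    using assms by (simp add: sum.inter_restrict[symmetric] Int_absorb1)
  finally show ?thesis .
qed

lemma tensor_form_conv_apply:
  assumes "finite S" "k \<ge> 1"
  shows "tensor_form k S T x = (\<Sum>i\<in>S. x i * tensor_apply k S T x i)"
proof -
  have "{ix. ix \<in> tensor_indices k S \<and> set (take 1 ix) \<subseteq> S} = tensor_indices k S"
    by (auto simp: tensor_indices_def dest: in_set_takeD)
  then show ?thesis
    using sum_form_split_first[OF assms(1) order_refl assms(2), of T x]
    by (simp add: tensor_form_def)
qed

lemma tensor_form_eigenvector: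
  assumes "finite S" "k \<ge> 1" "tensor_eigenvector k S T l x"
  shows "tensor_form k S T x = l * (\<Sum>i\<in>S. x i ^ k)"
proof -
  have "x i * tensor_apply k S T x i = l * x i ^ k" if "i \<in> S" for i
  proof -
    have "tensor_apply k S T x i = l * x i ^ (k - 1)"
      using assms(3) that by (simp add: tensor_eigenvector_def)
    then show ?thesis
      using assms(2) by (simp add: power_eq_if)
  qed
  then show ?thesis
    unfolding tensor_form_conv_apply[OF assms(1,2)] by (simp add: sum_distrib_left)
qed

lemma tensor_form_cmult: "tensor_form k S T (\<lambda>i. c * x i) = c ^ k * tensor_form k S T x"
proof -
  have "prod_list (map (\<lambda>i. c * x i) ix) = c ^ length ix * prod_list (map x ix)" for ix
    by (induction ix) (auto simp: mult_ac)
  then show ?thesis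
    by (auto simp: tensor_form_def sum_distrib_left tensor_indices_def mult_ac intro!: sum.cong)
qed

lemma tensor_form_nonneg:
  "nonneg_tensor k S T \<Longrightarrow> (\<And>i. i \<in> S \<Longrightarrow> 0 \<le> x i) \<Longrightarrow> 0 \<le> tensor_form k S T x"
  unfolding tensor_form_def
  by (intro sum_nonneg mult_nonneg_nonneg prod_list_map_nonneg)
     (auto simp: nonneg_tensor_def tensor_indices_def)

lemma tensor_apply_nonneg:
  fixes x :: "nat \<Rightarrow> real"
  assumes "nonneg_tensor k S T" "k \<ge> 1" "i \<in> S" "\<And>i. i \<in> S \<Longrightarrow> 0 \<le> x i"
  shows "0 \<le> tensor_apply k S T x i"
  unfolding tensor_apply_def
  using assms by (intro sum_nonneg mult_nonneg_nonneg prod_list_map_nonneg)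
     (auto simp: nonneg_tensor_def tensor_indices_def)

lemma tensor_form_cong:
  "(\<And>i. i \<in> S \<Longrightarrow> x i = y i) \<Longrightarrow> tensor_form k S T x = tensor_form k S T y"
  unfolding tensor_form_def
  by (intro sum.cong refl arg_cong2[where f = times] arg_cong[where f = prod_list] map_cong)
     (auto simp: tensor_indices_def)

lemma prod_list_map_zero:
  "i \<in> set ix \<Longrightarrow> x i = 0 \<Longrightarrow> prod_list (map x ix) = (0::real)"
  by (induction ix) auto

lemma tensor_form_extend_by_zero:
  assumes "finite S" "I \<subseteq> S"
  shows "tensor_form k S T (\<lambda>i. if i \<in> I then x i else 0) = tensor_form k I T x"
proof -
  have "tensor_form k S T (\<lambda>i. if i \<in> I then x i else 0) =
        tensor_form k I T (\<lambda>i. if i \<in> I then x i else 0)"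
    unfolding tensor_form_def
  proof (intro sum.mono_neutral_right ballI)
    fix ix assume "ix \<in> tensor_indices k S - tensor_indices k I"
    then obtain i where "i \<in> set ix" "i \<notin> I"
      by (auto simp: tensor_indices_def)
    then show "T ix * prod_list (map (\<lambda>i. if i \<in> I then x i else 0) ix) = 0"
      using prod_list_map_zero[of i ix] by simp
  qed (use assms finite_tensor_indices tensor_indices_mono in auto)
  also have "\<dots> = tensor_form k I T x"
    by (rule tensor_form_cong) auto
  finally show ?thesis .
qed

section \<open>Consequences of symmetry\<close>

text \<open>
  Symmetry enters only through this change of variables: moving the positions of the index tuple
  leaves the entries of \<open>T\<close> alone, so it may be performed on the remaining factor by itself.
\<close>

lemma symmetric_tensor_sum_permute:
  assumes "symmetric_tensor k S T" "p permutes {..<k}"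
  shows "(\<Sum>ix \<in> tensor_indices k S. T ix * F (permute_list p ix)) =
         (\<Sum>ix \<in> tensor_indices k S. T ix * (F ix :: real))"
proof -
  have inv: "inv p permutes {..<k}"
    using assms(2) by (rule permutes_inv)
  have undo: "permute_list (inv p) (permute_list p ix) = ix"
             "permute_list p (permute_list (inv p) ix) = ix"
    if "ix \<in> tensor_indices k S" for ix
    using that assms(2) inv permute_list_compose[of "inv p" ix p] permute_list_compose[of p ix "inv p"]
    by (auto simp: tensor_indices_def permutes_inv_o)
  have mem: "permute_list q ix \<in> tensor_indices k S"
    if "q permutes {..<k}" "ix \<in> tensor_indices k S" for q ix
    using that by (auto simp: tensor_indices_def)
  show ?thesis
    by (rule sum.reindex_bij_witness[where i = "permute_list (inv p)" and j = "permute_list p"])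
       (use assms inv undo mem in \<open>auto simp: symmetric_tensor_def\<close>)
qed

text \<open>
  The product rule yields one term for each position at which the index \<open>i\<close> can stand. By symmetry
  each of the \<open>k\<close> terms equals the one for position \<open>0\<close>, which is \<open>(T y\<^sup>k\<^sup>-\<^sup>1)\<^sub>i\<close>.
\<close>

lemma tensor_form_has_partial_derivative:
  assumes "finite S" "k \<ge> 1" "symmetric_tensor k S T" "i \<in> S"
  shows "((\<lambda>s. tensor_form k S T (y(i := s))) has_field_derivative
           real k * tensor_apply k S T y i) (at (y i))"
proof -
  \<comment> \<open>the factor of \<open>T ix\<close> in the derivative that comes from position \<open>p\<close>\<close>
  define F where "F = (\<lambda>p ix. of_bool (ix ! p = i) * (\<Prod>q\<in>{..<k} - {p}. y (ix ! q)))"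
  have form: "tensor_form k S T (y(i := s)) =
      (\<Sum>ix\<in>tensor_indices k S. T ix * (\<Prod>q<k. (y(i := s)) (ix ! q)))" for s
    unfolding tensor_form_def prod_list_map_conv_prod_nth
    by (intro sum.cong) (auto simp: tensor_indices_def)
  have coord: "((\<lambda>s. (y(i := s)) a) has_field_derivative of_bool (a = i)) (at (y i))" for a
    by (cases "a = i") auto
  have "((\<lambda>s. tensor_form k S T (y(i := s))) has_field_derivative
          (\<Sum>ix\<in>tensor_indices k S. T ix * (\<Sum>p<k. F p ix))) (at (y i))"
    unfolding form
  proof (intro DERIV_sum DERIV_cmult)
    fix ix
    show "((\<lambda>s. \<Prod>q<k. (y(i := s)) (ix ! q)) has_field_derivative (\<Sum>p<k. F p ix)) (at (y i))"
      using has_field_derivative_prod[of "{..<k}" "\<lambda>q s. (y(i := s)) (ix ! q)", OF coord]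
      by (simp add: F_def)
  qed
  moreover have "(\<Sum>ix\<in>tensor_indices k S. T ix * F p ix) =
                 (\<Sum>ix\<in>tensor_indices k S. T ix * F 0 ix)" if p: "p < k" for p
  proof -
    define \<tau> where "\<tau> = transpose 0 p"
    have perm: "\<tau> permutes {..<k}"
      using p by (auto simp: \<tau>_def intro!: permutes_swap_id)
    have "bij_betw \<tau> ({..<k} - {0}) ({..<k} - {p})"
      using p by (intro bij_betwI[where g = \<tau>]) (auto simp: \<tau>_def transpose_def)
    then have "F 0 (permute_list \<tau> ix) = F p ix" if "ix \<in> tensor_indices k S" for ix
      using that perm p prod.reindex_bij_betw[of \<tau> _ _ "\<lambda>q. y (ix ! q)"]
      by (auto simp: F_def tensor_indices_def permute_list_nth \<tau>_def)
    then show ?thesis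
      using symmetric_tensor_sum_permute[OF assms(3) perm, of "F 0"] by simp
  qed
  moreover have "(\<Sum>ix\<in>tensor_indices k S. T ix * F 0 ix) = tensor_apply k S T y i"
  proof -
    obtain m where k: "k = Suc m"
      using assms(2) by (cases k) auto
    have F0: "F 0 (j # ix) = (if j = i then prod_list (map y ix) else 0)"
      if "ix \<in> tensor_indices m S" for j ix
    proof -
      have "(\<Prod>q\<in>{..<Suc m} - {0}. y ((j # ix) ! q)) = (\<Prod>q<m. y (ix ! q))"
        by (rule prod.reindex_bij_witness[where i = Suc and j = "\<lambda>q. q - 1"]) auto
      then show ?thesis
        using that by (auto simp: F_def k prod_list_map_conv_prod_nth tensor_indices_def)
    qed
    have "(\<Sum>ix\<in>tensor_indices k S. T ix * F 0 ix) =
          (\<Sum>j\<in>S. if j = i then tensor_apply k S T y j else 0)"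
      unfolding k sum_tensor_indices_Suc[OF assms(1)]
      by (intro sum.cong refl) (auto simp: tensor_apply_def F0)
    then show ?thesis
      using assms by simp
  qed
  moreover have "(\<Sum>ix\<in>tensor_indices k S. T ix * (\<Sum>p<k. F p ix)) =
                 (\<Sum>p<k. \<Sum>ix\<in>tensor_indices k S. T ix * F p ix)"
    unfolding sum_distrib_left by (rule sum.swap)
  ultimately show ?thesis
    by simp
qed

section \<open>The spectral radius as a maximum\<close>

text \<open>
  Vectors are functions on all naturals, so the coordinates outside \<open>S\<close> are pinned to \<open>0\<close>; the
  cube is then a product of compact intervals and Tychonoff's theorem applies.
\<close>

lemma nonneg_unit_sphere_compact:
  assumes "k \<ge> 1" "finite S"
  shows "compact (PiE UNIV (\<lambda>i. if i \<in> S then {0..1} else {0}) \<inter> {y :: nat \<Rightarrow> real. (\<Sum>i\<in>S. y i ^ k) = 1})"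
proof -
  define B :: "nat \<Rightarrow> real set" where "B = (\<lambda>i. if i \<in> S then {0..1} else {0})"
  have "compactin (product_topology (\<lambda>i. euclidean) UNIV) (PiE UNIV B)"
    by (subst compactin_PiE) (auto simp: B_def)
  then have "compact (PiE UNIV B)"
    by (simp add: euclidean_product_topology)
  moreover have "closed {y :: nat \<Rightarrow> real. (\<Sum>i\<in>S. y i ^ k) = 1}"
    by (intro closed_Collect_eq continuous_intros continuous_on_product_coordinates)
  ultimately have "compact (PiE UNIV B \<inter> {y. (\<Sum>i\<in>S. y i ^ k) = 1})"
    by (rule compact_Int_closed)
  then show ?thesis
    by (simp add: B_def)
qed

text \<open>
  The bound for arbitrary nonnegative vectors follows from the one on the unit sphere by
  homogeneity. Stating it without normalization lets a single coordinate be varied freely when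
  the first-order conditions are derived.
\<close>

lemma tensor_form_attains_max:
  assumes "finite S" "S \<noteq> {}" "k \<ge> 1"
  obtains y where "\<And>i. i \<in> S \<Longrightarrow> 0 \<le> y i" "(\<Sum>i\<in>S. y i ^ k) = 1"
    "\<And>z. (\<And>i. i \<in> S \<Longrightarrow> 0 \<le> z i) \<Longrightarrow>
       tensor_form k S T z \<le> tensor_form k S T y * (\<Sum>i\<in>S. z i ^ k)"
proof -
  define K where "K = (PiE UNIV (\<lambda>i. if i \<in> S then {0..1} else {0}) \<inter> {y :: nat \<Rightarrow> real. (\<Sum>i\<in>S. y i ^ k) = 1})"
  obtain a where a: "a \<in> S"
    using assms(2) by auto
  have "(\<Sum>j\<in>S. (if j = a then 1 else 0) ^ k) = (\<Sum>j\<in>S. if j = a then 1 else (0::real))"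
    using assms(3) by (intro sum.cong) auto
  then have "(\<lambda>j. if j = a then 1 else 0) \<in> K"
    using a assms(1) by (auto simp: K_def PiE_iff)
  moreover have "continuous_on K (tensor_form k S T)"
    unfolding tensor_form_def prod_list_map_conv_prod_nth
    by (intro continuous_intros continuous_on_subset[OF continuous_on_product_coordinates]) auto
  ultimately obtain y where y: "y \<in> K" "\<And>z. z \<in> K \<Longrightarrow> tensor_form k S T z \<le> tensor_form k S T y"
    using continuous_attains_sup[of K "tensor_form k S T"] nonneg_unit_sphere_compact[OF assms(3,1)]
    unfolding K_def[symmetric] by blast
  show thesis
  proof (rule that[of y])
    show "0 \<le> y i" if "i \<in> S" for i
      using y(1) that by (auto simp: K_def PiE_iff split: if_splits dest!: spec[where x = i])
    show "(\<Sum>i\<in>S. y i ^ k) = 1"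
      using y(1) by (simp add: K_def)
  next
    fix z :: "nat \<Rightarrow> real" assume z: "\<And>i. i \<in> S \<Longrightarrow> 0 \<le> z i"
    define N where "N = (\<Sum>i\<in>S. z i ^ k)"
    define c where "c = root k N"
    have le_N: "z i ^ k \<le> N" if "i \<in> S" for i
      using z assms(1) that unfolding N_def by (auto intro!: member_le_sum)
    have N: "N \<ge> 0"
      unfolding N_def using z by (intro sum_nonneg) auto
    then have c: "c ^ k = N" "c \<ge> 0"
      using assms(3) by (auto simp: c_def)
    have z_le: "z i \<le> c" if "i \<in> S" for i
      using le_N[OF that] c power_le_imp_le_base[of "z i" "k - 1" c] assms(3) by simp
    define w where "w = (\<lambda>i. if i \<in> S then z i / c else 0)"
    have zw: "z i = c * w i" if "i \<in> S" for i
      using z_le[OF that] z[OF that] by (auto simp: w_def that)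
    have form_z: "tensor_form k S T z = N * tensor_form k S T w"
      using tensor_form_cong[OF zw] tensor_form_cmult[of k S T c w] c by simp
    show "tensor_form k S T z \<le> tensor_form k S T y * (\<Sum>i\<in>S. z i ^ k)"
    proof (cases "N = 0")
      case True
      then show ?thesis
        using form_z by (simp flip: N_def)
    next
      case False
      then have "c > 0"
        using c assms(3) by (cases "c = 0") (auto simp: zero_power)
      moreover have "(\<Sum>i\<in>S. w i ^ k) = 1"
        using False c by (simp add: w_def power_divide N_def flip: sum_divide_distrib)
      ultimately have "w \<in> K"
        using z z_le by (auto simp: K_def w_def PiE_iff)
      then show ?thesis
        using y(2)[of w] N form_z by (simp add: mult.commute mult_left_mono flip: N_def)
    qed
  qed
qed

text \<open>
  Let \<open>M\<close> be the maximum. The function \<open>T z\<^sup>k - M \<Sum> z\<^sub>j\<^sup>k\<close> is nonpositive on the nonnegative orthant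
  and vanishes at \<open>y\<close>, so its derivative in direction \<open>i\<close> is zero if \<open>y\<^sub>i > 0\<close>, which is the
  eigenvalue equation. If \<open>y\<^sub>i = 0\<close>, only \<open>(T y\<^sup>k\<^sup>-\<^sup>1)\<^sub>i \<le> M y\<^sub>i\<^sup>k\<^sup>-\<^sup>1 = 0\<close> can be concluded
  from maximality; nonnegativity of \<open>T\<close> supplies the opposite inequality.
\<close>

lemma tensor_form_maximizer_eigenvector:
  assumes "finite S" "k \<ge> 2" "symmetric_tensor k S T" "nonneg_tensor k S T"
    and y: "\<And>i. i \<in> S \<Longrightarrow> 0 \<le> y i" "(\<Sum>i\<in>S. y i ^ k) = 1"
    and max: "\<And>z. (\<And>i. i \<in> S \<Longrightarrow> 0 \<le> z i) \<Longrightarrow> tensor_form k S T z \<le> tensor_form k S T y * (\<Sum>i\<in>S. z i ^ k)"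
  shows "tensor_eigenvector k S T (tensor_form k S T y) y"
  unfolding tensor_eigenvector_def
proof (intro conjI ballI)
  show "\<exists>i\<in>S. y i \<noteq> 0"
  proof (rule ccontr)
    assume "\<not> ?thesis"
    then have "(\<Sum>i\<in>S. y i ^ k) = 0"
      using assms(2) by (intro sum.neutral) auto
    then show False using y(2) by simp
  qed
next
  fix i assume i: "i \<in> S"
  define M where "M = tensor_form k S T y"
  define h where "h = (\<lambda>s. tensor_form k S T (y(i := s)) - M * (\<Sum>j\<in>S. (y(i := s)) j ^ k))"
  define D where "D = real k * (tensor_apply k S T y i - M * y i ^ (k - 1))"
  have h_le: "h s \<le> h (y i)" if "s \<ge> 0" for s
    using max[of "y(i := s)"] that y unfolding h_def M_def fun_upd_triv by simp
  have "((\<lambda>s. \<Sum>j\<in>S. (y(i := s)) j ^ k) has_field_derivative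
          (\<Sum>j\<in>S. if j = i then real k * y i ^ (k - 1) else 0)) (at (y i))"
  proof (rule DERIV_sum)
    fix j
    show "((\<lambda>s. (y(i := s)) j ^ k) has_field_derivative (if j = i then real k * y i ^ (k - 1) else 0)) (at (y i))"
      using DERIV_pow[of k "y i" UNIV] by (cases "j = i") auto
  qed
  then have "((\<lambda>s. \<Sum>j\<in>S. (y(i := s)) j ^ k) has_field_derivative real k * y i ^ (k - 1)) (at (y i))"
    using i assms(1) by simp
  moreover have "((\<lambda>s. tensor_form k S T (y(i := s))) has_field_derivative
      real k * tensor_apply k S T y i) (at (y i))"
    using assms(1-3) i by (intro tensor_form_has_partial_derivative) auto
  ultimately have "(h has_field_derivative
      real k * tensor_apply k S T y i - M * (real k * y i ^ (k - 1))) (at (y i))"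
    unfolding h_def by (intro DERIV_diff DERIV_cmult)
  then have der: "(h has_field_derivative D) (at (y i))"
    by (simp add: D_def algebra_simps)
  have "D = 0"
  proof (cases "y i = 0")
    case False
    then have "y i > 0"
      using y(1)[OF i] by simp
    then show ?thesis
      using DERIV_local_max[OF der, of "y i"] h_le by (auto simp: abs_if split: if_splits)
  next
    case True
    have "D \<le> 0"
    proof (rule ccontr)
      assume "\<not> D \<le> 0"
      then obtain d where d: "d > 0" "\<And>e. 0 < e \<Longrightarrow> e < d \<Longrightarrow> h (y i) < h (y i + e)"
        using DERIV_pos_inc_right[OF der] by auto
      then have "h (y i) < h (y i + d / 2)"
        by simp
      then show False
        using h_le[of "y i + d / 2"] y(1)[OF i] d(1) by simp
    qed
    moreover have "D \<ge> 0"
      using True tensor_apply_nonneg[OF assms(4) _ i y(1)] assms(2)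
      by (simp add: D_def zero_power)
    ultimately show ?thesis by simp
  qed
  then show "tensor_form k S T y * y i ^ (k - 1) = tensor_apply k S T y i"
    using assms(2) by (simp add: D_def M_def)
qed

text \<open>
  With \<open>z = \<bar>x\<bar>\<close>, the triangle inequality gives
  \<open>\<bar>l\<bar> z\<^sub>i\<^sup>k\<^sup>-\<^sup>1 \<le> (T z\<^sup>k\<^sup>-\<^sup>1)\<^sub>i\<close>. Multiplying by \<open>z\<^sub>i\<close> and summing over \<open>i\<close> bounds
  \<open>\<bar>l\<bar> \<Sum> z\<^sub>i\<^sup>k\<close> by \<open>T z\<^sup>k\<close>.
\<close>

lemma tensor_eigenvalue_cmod_le:
  assumes "finite S" "k \<ge> 1" "nonneg_tensor k S T" "tensor_eigenvalue k S T l"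
    and bound: "\<And>z. (\<And>i. i \<in> S \<Longrightarrow> 0 \<le> z i) \<Longrightarrow> tensor_form k S T z \<le> M * (\<Sum>i\<in>S. z i ^ k)"
  shows "cmod l \<le> M"
proof -
  obtain x :: "nat \<Rightarrow> complex" where x: "tensor_eigenvector k S T l x"
    using assms(4) by (auto simp: tensor_eigenvalue_def)
  define z where "z = (\<lambda>i. cmod (x i))"
  have cmod_prod: "cmod (prod_list (map x ix)) = prod_list (map z ix)" for ix
    by (induction ix) (auto simp: z_def norm_mult)
  have *: "cmod l * z i ^ (k - 1) \<le> tensor_apply k S T z i" if i: "i \<in> S" for i
  proof -
    have "cmod l * z i ^ (k - 1) = cmod (tensor_apply k S T x i)"
      using x i by (auto simp: tensor_eigenvector_def z_def simp flip: norm_power norm_mult)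
    also have "\<dots> \<le> (\<Sum>ix\<in>tensor_indices (k - 1) S.
                      cmod (of_real (T (i # ix)) * prod_list (map x ix)))"
      unfolding tensor_apply_def by (rule norm_sum)
    also have "\<dots> = tensor_apply k S T z i"
      unfolding tensor_apply_def using assms(2,3) i
      by (intro sum.cong)
         (auto simp: norm_mult cmod_prod nonneg_tensor_def tensor_indices_def)
    finally show ?thesis .
  qed
  have "cmod l * (\<Sum>i\<in>S. z i ^ k) = (\<Sum>i\<in>S. z i * (cmod l * z i ^ (k - 1)))"
    unfolding sum_distrib_left
    using assms(2) by (intro sum.cong) (auto simp: power_eq_if)
  also have "\<dots> \<le> (\<Sum>i\<in>S. z i * tensor_apply k S T z i)"
    by (intro sum_mono mult_left_mono *) (auto simp: z_def)
  also have "\<dots> \<le> M * (\<Sum>i\<in>S. z i ^ k)"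
    unfolding tensor_form_conv_apply[OF assms(1,2), symmetric] by (rule bound) (simp add: z_def)
  finally have "cmod l * (\<Sum>i\<in>S. z i ^ k) \<le> M * (\<Sum>i\<in>S. z i ^ k)" .
  moreover have "(\<Sum>i\<in>S. z i ^ k) > 0"
    using x assms(1) by (auto simp: tensor_eigenvector_def z_def intro!: sum_pos2)
  ultimately show ?thesis by simp
qed

lemma tensor_eigenvalue_of_real:
  assumes "tensor_eigenvector k S T (l::real) x"
  shows "tensor_eigenvalue k S T (of_real l)"
proof -
  have "prod_list (map (\<lambda>i. of_real (x i)) ix) = (of_real (prod_list (map x ix)) :: complex)" for ix
    by (induction ix) auto
  then have "tensor_apply k S T (\<lambda>i. of_real (x i)) i = (of_real (tensor_apply k S T x i) :: complex)" for i
    by (simp add: tensor_apply_def)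
  then have "tensor_eigenvector k S T (complex_of_real l) (\<lambda>i. of_real (x i))"
    using assms by (simp add: tensor_eigenvector_def flip: of_real_power of_real_mult)
  then show ?thesis
    by (auto simp: tensor_eigenvalue_def)
qed

text \<open>
  The maximal value of the form is an eigenvalue and dominates all others in modulus. In
  particular the greatest modulus that defines the spectral radius exists.
\<close>

lemma tensor_spectral_radius_attained:
  assumes "finite S" "S \<noteq> {}" "k \<ge> 2" "symmetric_tensor k S T" "nonneg_tensor k S T"
  obtains y where "\<And>i. i \<in> S \<Longrightarrow> 0 \<le> y i" "(\<Sum>i\<in>S. y i ^ k) = 1"
    "tensor_form k S T y = tensor_spectral_radius k S T"
    "\<And>z. (\<And>i. i \<in> S \<Longrightarrow> 0 \<le> z i) \<Longrightarrow>
       tensor_form k S T z \<le> tensor_spectral_radius k S T * (\<Sum>i\<in>S. z i ^ k)"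
proof -
  have k: "k \<ge> 1"
    using assms(3) by simp
  obtain y where y: "\<And>i. i \<in> S \<Longrightarrow> 0 \<le> y i" "(\<Sum>i\<in>S. y i ^ k) = 1"
    "\<And>z. (\<And>i. i \<in> S \<Longrightarrow> 0 \<le> z i) \<Longrightarrow> tensor_form k S T z \<le> tensor_form k S T y * (\<Sum>i\<in>S. z i ^ k)"
    using tensor_form_attains_max[OF assms(1,2) k, of T] by blast
  let ?M = "tensor_form k S T y"
  have "?M \<ge> 0"
    using tensor_form_nonneg[OF assms(5) y(1)] .
  moreover have "tensor_eigenvalue k S T (of_real ?M)"
    using tensor_form_maximizer_eigenvector[OF assms(1,3-5) y] by (rule tensor_eigenvalue_of_real)
  ultimately have "tensor_spectral_radius k S T = ?M"
    unfolding tensor_spectral_radius_def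
    using tensor_eigenvalue_cmod_le[OF assms(1) k assms(5) _ y(3)]
    by (intro Greatest_equality) (auto intro!: exI[of _ "of_real ?M"])
  then show thesis
    using y by (intro that[of y]) auto
qed

corollary tensor_form_le_spectral_radius:
  assumes "finite S" "S \<noteq> {}" "k \<ge> 2" "symmetric_tensor k S T" "nonneg_tensor k S T"
    and "\<And>i. i \<in> S \<Longrightarrow> 0 \<le> z i"
  shows "tensor_form k S T z \<le> tensor_spectral_radius k S T * (\<Sum>i\<in>S. z i ^ k)"
  by (rule tensor_spectral_radius_attained[OF assms(1-5)]) (use assms(6) in simp)

section \<open>Principal subtensors\<close>

lemma tensor_form_principal_subtensor:
  "tensor_form k I (principal_subtensor k T I) x = tensor_form k I T x"
  by (simp add: tensor_form_def principal_subtensor_def)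

lemma symmetric_principal_subtensor:
  assumes "symmetric_tensor k S T" "I \<subseteq> S"
  shows "symmetric_tensor k I (principal_subtensor k T I)"
  using assms tensor_indices_mono[OF assms(2)]
  by (auto simp: symmetric_tensor_def principal_subtensor_def restrict_def tensor_indices_def)

lemma nonneg_principal_subtensor:
  assumes "nonneg_tensor k S T" "I \<subseteq> S"
  shows "nonneg_tensor k I (principal_subtensor k T I)"
  using assms tensor_indices_mono[OF assms(2)]
  by (auto simp: nonneg_tensor_def principal_subtensor_def)

lemma spectral_radius_principal_subtensor_le:
  assumes "finite S" "I \<noteq> {}" "I \<subseteq> S" "k \<ge> 2" "symmetric_tensor k S T" "nonneg_tensor k S T"
  shows "tensor_spectral_radius k I (principal_subtensor k T I) \<le> tensor_spectral_radius k S T"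
proof -
  obtain y where y: "\<And>i. i \<in> I \<Longrightarrow> 0 \<le> y i" "(\<Sum>i\<in>I. y i ^ k) = 1"
    "tensor_form k I (principal_subtensor k T I) y =
       tensor_spectral_radius k I (principal_subtensor k T I)"
    "\<And>z. (\<And>i. i \<in> I \<Longrightarrow> 0 \<le> z i) \<Longrightarrow>
       tensor_form k I (principal_subtensor k T I) z \<le>
       tensor_spectral_radius k I (principal_subtensor k T I) * (\<Sum>i\<in>I. z i ^ k)"
    using tensor_spectral_radius_attained[OF finite_subset[OF assms(3,1)] assms(2,4)
        symmetric_principal_subtensor[OF assms(5,3)] nonneg_principal_subtensor[OF assms(6,3)]]
    by blast
  define z where "z = (\<lambda>i. if i \<in> I then y i else 0)"
  have "(\<Sum>i\<in>S. z i ^ k) = (\<Sum>i\<in>S. if i \<in> I then y i ^ k else 0)"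
    using assms(4) by (intro sum.cong) (auto simp: z_def)
  then have unit: "(\<Sum>i\<in>S. z i ^ k) = 1"
    using assms y(2) by (simp add: sum.inter_restrict[symmetric] Int_absorb1)
  have "S \<noteq> {}"
    using assms by auto
  then have "tensor_form k S T z \<le> tensor_spectral_radius k S T * (\<Sum>i\<in>S. z i ^ k)"
    using y(1) by (intro tensor_form_le_spectral_radius assms) (auto simp: z_def)
  then show ?thesis
    using unit y(3) tensor_form_extend_by_zero[OF assms(1,3)]
    by (simp add: z_def tensor_form_principal_subtensor)
qed

section \<open>Inclusion-exclusion\<close>

text \<open>
  Listing \<open>A\<close> first and its complement afterwards rearranges \<open>[0..<k]\<close>; the rearrangement is the
  permutation sought.
\<close>

lemma permutation_onto_subset:
  assumes "A \<subseteq> {..<k}"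
  obtains p where "p permutes {..<k}" "p ` {..<card A} = A"
proof -
  define ys where "ys = sorted_list_of_set A @ sorted_list_of_set ({..<k} - A)"
  have fin: "finite A"
    using assms finite_subset by blast
  have "mset ys = mset [0..<k]"
    using assms fin by (intro set_eq_iff_mset_eq_distinct[THEN iffD1]) (auto simp: ys_def)
  then obtain p where p: "p permutes {..<length [0..<k]}" "permute_list p [0..<k] = ys"
    by (rule mset_eq_permutation)
  have "p q = ys ! q" if "q < k" for q
    using p that permutes_in_image[OF p(1), of q] permute_list_nth[OF p(1), of q] by auto
  moreover have cardA: "card A \<le> k"
    using card_mono[OF _ assms] by simp
  ultimately have "p ` {..<card A} = (\<lambda>q. sorted_list_of_set A ! q) ` {..<card A}"
    by (intro image_cong) (auto simp: ys_def nth_append)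
  also have "\<dots> = A"
    using fin nth_image[of "card A" "sorted_list_of_set A"] by (simp add: atLeast0LessThan)
  finally show thesis
    using p(1) that[of p] by simp
qed

text \<open>
  With \<open>c\<close> the number of positions of an index tuple outside \<open>I\<close>, this is the indicator that the
  tuple lies in \<open>I\<close>.
\<close>

lemma alternating_binomial_truncated:
  assumes "c \<le> k"
  shows "(\<Sum>m\<le>k. (-1) ^ m * real (c choose m)) = of_bool (c = 0)"
proof -
  have "(\<Sum>m\<le>k. (-1) ^ m * real (c choose m)) = (\<Sum>m\<le>c. (-1) ^ m * real (c choose m))"
    using assms by (intro sum.mono_neutral_right) auto
  then show ?thesis
    using choose_alternating_sum[of c, where 'a = real] by (cases "c = 0") auto
qed

text \<open>
  By symmetry, the sum over tuples whose positions in \<open>A\<close> all lie outside \<open>I\<close> depends only on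
  \<open>\<bar>A\<bar>\<close>. So \<open>k choose m\<close> times the sum for the first \<open>m\<close> positions is the total over all
  \<open>m\<close>-element sets \<open>A\<close>, in which a tuple with \<open>c\<close> positions outside \<open>I\<close> is counted
  \<open>c choose m\<close> times. The alternating sum of these multiplicities vanishes unless \<open>c = 0\<close>.
\<close>

lemma tensor_form_inclusion_exclusion:
  assumes "finite S" "I \<subseteq> S" "symmetric_tensor k S T"
  shows "tensor_form k I T x =
    (\<Sum>m\<le>k. (-1) ^ m * real (k choose m) *
       (\<Sum>ix | ix \<in> tensor_indices k S \<and> set (take m ix) \<subseteq> S - I. T ix * prod_list (map x ix)))"
proof -
  define P where "P = (\<lambda>ix. {q. q < k \<and> ix ! q \<notin> I})"
  define G where "G = (\<lambda>A. \<Sum>ix\<in>tensor_indices k S. T ix * (prod_list (map x ix) * of_bool (A \<subseteq> P ix)))"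
  have fin: "finite (tensor_indices k S)"
    using assms(1) by (rule finite_tensor_indices)
  have G_card: "G A = G {..<card A}" if A: "A \<subseteq> {..<k}" for A
  proof -
    obtain p where p: "p permutes {..<k}" "p ` {..<card A} = A"
      using permutation_onto_subset[OF A] .
    have cardA: "card A \<le> k"
      using card_mono[OF _ A] by simp
    have "prod_list (map x (permute_list p ix)) = prod_list (map x ix)"
      if "ix \<in> tensor_indices k S" for ix
      using that p(1) by (simp add: tensor_indices_def flip: prod_mset_prod_list)
    moreover have "{..<card A} \<subseteq> P (permute_list p ix) \<longleftrightarrow> A \<subseteq> P ix"
      if "ix \<in> tensor_indices k S" for ix
    proof -
      have "{..<card A} \<subseteq> P (permute_list p ix) \<longleftrightarrow> p ` {..<card A} \<subseteq> P ix"
        using that p(1) cardA permutes_in_image[OF p(1)]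
        by (fastforce simp: P_def tensor_indices_def permute_list_nth subset_iff)
      then show ?thesis by (simp add: p(2))
    qed
    ultimately show ?thesis
      using symmetric_tensor_sum_permute[OF assms(3) p(1),
          of "\<lambda>ix. prod_list (map x ix) * of_bool ({..<card A} \<subseteq> P ix)"]
      by (simp add: G_def cong: sum.cong)
  qed
  have G_initial: "G {..<m} =
      (\<Sum>ix | ix \<in> tensor_indices k S \<and> set (take m ix) \<subseteq> S - I. T ix * prod_list (map x ix))"
    if "m \<le> k" for m
  proof -
    have "{..<m} \<subseteq> P ix \<longleftrightarrow> set (take m ix) \<subseteq> S - I" if ix: "ix \<in> tensor_indices k S" for ix
    proof -
      have "set (take m ix) = (!) ix ` {..<m}"
        using ix \<open>m \<le> k\<close> nth_image[of m ix] by (simp add: tensor_indices_def atLeast0LessThan)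
      moreover have "ix ! q \<in> S" if "q < k" for q
        using ix that nth_mem[of q ix] by (auto simp: tensor_indices_def)
      ultimately show ?thesis
        using \<open>m \<le> k\<close> by (auto simp: P_def)
    qed
    then show ?thesis
      unfolding G_def sum.inter_filter[OF fin] by (intro sum.cong) auto
  qed
  have count: "real (k choose m) * G {..<m} =
      (\<Sum>ix\<in>tensor_indices k S. T ix * prod_list (map x ix) * real (card (P ix) choose m))" for m
  proof -
    define \<A> where "\<A> = {A. A \<subseteq> {..<k} \<and> card A = m}"
    have fin_\<A>: "finite \<A>"
      by (rule finite_subset[of _ "Pow {..<k}"]) (auto simp: \<A>_def)
    have "real (k choose m) * G {..<m} = (\<Sum>A\<in>\<A>. G {..<m})"
      using n_subsets[of "{..<k}" m] by (simp add: \<A>_def)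
    also have "\<dots> = (\<Sum>A\<in>\<A>. G A)"
      by (intro sum.cong) (auto simp: \<A>_def G_card)
    also have "\<dots> = (\<Sum>ix\<in>tensor_indices k S. \<Sum>A\<in>\<A>. T ix * (prod_list (map x ix) * of_bool (A \<subseteq> P ix)))"
      unfolding G_def by (rule sum.swap)
    also have "\<dots> = (\<Sum>ix\<in>tensor_indices k S. T ix * prod_list (map x ix) * real (card (P ix) choose m))"
    proof (intro sum.cong refl)
      fix ix
      have "\<A> \<inter> {A. A \<subseteq> P ix} = {A. A \<subseteq> P ix \<and> card A = m}"
        by (auto simp: \<A>_def P_def)
      then have "(\<Sum>A\<in>\<A>. of_bool (A \<subseteq> P ix)) = real (card (P ix) choose m)"
        using n_subsets[of "P ix" m] fin_\<A> by (simp add: P_def)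
      then show "(\<Sum>A\<in>\<A>. T ix * (prod_list (map x ix) * of_bool (A \<subseteq> P ix))) =
          T ix * prod_list (map x ix) * real (card (P ix) choose m)"
        by (simp add: mult.assoc flip: sum_distrib_left)
    qed
    finally show ?thesis .
  qed
  have "(\<Sum>m\<le>k. (-1) ^ m * real (k choose m) *
       (\<Sum>ix | ix \<in> tensor_indices k S \<and> set (take m ix) \<subseteq> S - I. T ix * prod_list (map x ix))) =
     (\<Sum>m\<le>k. (-1) ^ m * (real (k choose m) * G {..<m}))"
    by (intro sum.cong) (auto simp: G_initial)
  also have "\<dots> = (\<Sum>ix\<in>tensor_indices k S. \<Sum>m\<le>k.
      T ix * prod_list (map x ix) * ((-1) ^ m * real (card (P ix) choose m)))"
    unfolding count sum_distrib_left by (subst sum.swap) (simp add: mult_ac)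
  also have "\<dots> = (\<Sum>ix\<in>tensor_indices k S. T ix * prod_list (map x ix) * of_bool (card (P ix) = 0))"
  proof (intro sum.cong refl)
    fix ix
    have "card (P ix) \<le> k"
      using card_mono[of "{..<k}" "P ix"] by (auto simp: P_def)
    then show "(\<Sum>m\<le>k. T ix * prod_list (map x ix) * ((-1) ^ m * real (card (P ix) choose m))) =
        T ix * prod_list (map x ix) * of_bool (card (P ix) = 0)"
      by (simp add: alternating_binomial_truncated flip: sum_distrib_left)
  qed
  also have "\<dots> = (\<Sum>ix\<in>tensor_indices k I. T ix * prod_list (map x ix))"
  proof -
    have "P ix = {}" if "ix \<in> tensor_indices k I" for ix
      using that by (auto simp: P_def tensor_indices_def)
    moreover have "card (P ix) \<noteq> 0"
      if "ix \<in> tensor_indices k S" "ix \<notin> tensor_indices k I" for ix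
      using that by (auto simp: P_def tensor_indices_def in_set_conv_nth subset_iff)
    ultimately show ?thesis
      using tensor_indices_mono[OF assms(2), of k] fin
      by (intro sum.mono_neutral_cong_right) auto
  qed
  finally show ?thesis
    by (simp add: tensor_form_def)
qed

theorem theorem4p2:
  fixes k n :: nat and T :: "nat list \<Rightarrow> real" and x :: "nat \<Rightarrow> real" and I :: "nat set"
  assumes "k \<ge> 2" and "n \<ge> 2"
    and "symmetric_tensor k {1..n} T"
    and "nonneg_tensor k {1..n} T"
    and "zero_diagonal_tensor k {1..n} T"
    and "tensor_eigenvector k {1..n} T (lambda_max k {1..n} T) x"
    and "unit_vector k {1..n} x"
    and "\<forall>i\<in>{1..n}. 0 \<le> x i"
    and "I \<noteq> {}" and "I \<subset> {1..n}"
    and "(\<Sum>i\<in>I. x i ^ k) \<noteq> 0"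
  shows "(lambda_max k {1..n} T * (1 - real k * (\<Sum>i\<in>{1..n} - I. x i ^ k))
           - (\<Sum>j=1..k-1. (-1) ^ j * real (k choose (j + 1)) *
               (\<Sum>ix | length ix = k \<and> set (take (j + 1) ix) \<subseteq> {1..n} - I
                      \<and> set (drop (j + 1) ix) \<subseteq> {1..n}.
                  T ix * prod_list (map x ix))))
         / (\<Sum>i\<in>I. x i ^ k)
         \<le> tensor_spectral_radius k I (principal_subtensor k T I)
       \<and> tensor_spectral_radius k I (principal_subtensor k T I)
         \<le> tensor_spectral_radius k {1..n} T"
proof -
  let ?S = "{1..n}" and ?l = "lambda_max k {1..n} T"
  let ?\<sigma> = "\<lambda>m. \<Sum>ix | ix \<in> tensor_indices k ?S \<and> set (take m ix) \<subseteq> ?S - I. T ix * prod_list (map x ix)"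
  note sym = assms(3) and nonneg = assms(4) and eig = assms(6)
  have I: "I \<subseteq> ?S" and k1: "k \<ge> 1"
    using assms by auto
  have unit: "(\<Sum>i\<in>?S. x i ^ k) = 1"
    using assms(7,8) by (simp add: unit_vector_def)
  have "?\<sigma> 0 = tensor_form k ?S T x"
    by (simp add: tensor_form_def)
  then have \<sigma>0: "?\<sigma> 0 = ?l"
    using tensor_form_eigenvector[OF _ k1 eig] unit by simp
  have "?\<sigma> 1 = (\<Sum>i\<in>?S - I. x i * tensor_apply k ?S T x i)"
    by (rule sum_form_split_first) (use k1 in auto)
  also have "\<dots> = (\<Sum>i\<in>?S - I. ?l * x i ^ k)"
  proof (intro sum.cong refl)
    fix i assume "i \<in> ?S - I"
    then have "tensor_apply k ?S T x i = ?l * x i ^ (k - 1)"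
      using eig by (simp add: tensor_eigenvector_def)
    then show "x i * tensor_apply k ?S T x i = ?l * x i ^ k"
      using k1 by (simp add: power_eq_if)
  qed
  finally have \<sigma>1: "?\<sigma> 1 = ?l * (\<Sum>i\<in>?S - I. x i ^ k)"
    by (simp add: sum_distrib_left)
  have index_set: "{ix. length ix = k \<and> set (take m ix) \<subseteq> ?S - I \<and> set (drop m ix) \<subseteq> ?S} =
      {ix. ix \<in> tensor_indices k ?S \<and> set (take m ix) \<subseteq> ?S - I}" for m
  proof (rule Collect_cong)
    fix ix :: "nat list"
    have "set ix \<subseteq> ?S \<longleftrightarrow> set (take m ix) \<subseteq> ?S \<and> set (drop m ix) \<subseteq> ?S"
      by (metis append_take_drop_id set_append Un_subset_iff)
    then show "length ix = k \<and> set (take m ix) \<subseteq> ?S - I \<and> set (drop m ix) \<subseteq> ?S \<longleftrightarrow>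
        ix \<in> tensor_indices k ?S \<and> set (take m ix) \<subseteq> ?S - I"
      unfolding tensor_indices_def by blast
  qed
  \<comment> \<open>The order-\<open>(j + 1)\<close> term carries the sign \<open>- (- 1) ^ j\<close>; splitting off \<open>j = 0\<close> leaves the sum in
    the theorem.\<close>
  obtain r where r: "k = Suc r"
    using k1 by (cases k) auto
  have "tensor_form k I T x = (\<Sum>m\<le>k. (-1) ^ m * real (k choose m) * ?\<sigma> m)"
    by (rule tensor_form_inclusion_exclusion[OF _ I sym]) simp
  also have "\<dots> = ?\<sigma> 0 - (\<Sum>j\<le>r. (-1) ^ j * real (k choose (j + 1)) * ?\<sigma> (j + 1))"
    unfolding r sum.atMost_Suc_shift by (simp add: sum_negf)
  also have "(\<Sum>j\<le>r. (-1) ^ j * real (k choose (j + 1)) * ?\<sigma> (j + 1)) =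
      real k * ?\<sigma> 1 + (\<Sum>j=1..k - 1. (-1) ^ j * real (k choose (j + 1)) * ?\<sigma> (j + 1))"
    unfolding atMost_atLeast0 by (subst sum.atLeast_Suc_atMost) (simp_all add: r)
  finally have numerator: "tensor_form k I T x =
      ?l * (1 - real k * (\<Sum>i\<in>?S - I. x i ^ k))
        - (\<Sum>j=1..k - 1. (-1) ^ j * real (k choose (j + 1)) * ?\<sigma> (j + 1))"
    unfolding \<sigma>0 \<sigma>1 by (simp add: algebra_simps)
  have nonneg_x: "0 \<le> x i" if "i \<in> I" for i
    using assms(8) I that by auto
  then have "(\<Sum>i\<in>I. x i ^ k) \<ge> 0"
    by (intro sum_nonneg) auto
  then have pos: "(\<Sum>i\<in>I. x i ^ k) > 0"
    using assms(11) by simp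
  have "tensor_form k I (principal_subtensor k T I) x \<le>
        tensor_spectral_radius k I (principal_subtensor k T I) * (\<Sum>i\<in>I. x i ^ k)"
    using finite_subset[OF I] nonneg_x
    by (intro tensor_form_le_spectral_radius assms(1,9)
        symmetric_principal_subtensor[OF sym I] nonneg_principal_subtensor[OF nonneg I]) auto
  then have "tensor_form k I T x / (\<Sum>i\<in>I. x i ^ k) \<le>
        tensor_spectral_radius k I (principal_subtensor k T I)"
    using pos by (simp add: tensor_form_principal_subtensor divide_le_eq)
  moreover have "tensor_spectral_radius k I (principal_subtensor k T I) \<le> tensor_spectral_radius k ?S T"
    by (rule spectral_radius_principal_subtensor_le[OF _ assms(9) I assms(1) sym nonneg]) simp
  ultimately show ?thesis
    unfolding numerator index_set by blast
qed

end
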